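(* Let $c_0=1$, let $c_1,\ldots,c_d$ be multiplicatively independent non-zero integers, and let $\Gamma$ be a bipartite graph on the vertex set $\{0,1,\dots,d\}$. Then for every $\epsilon>0$ there is a Borel set $A\subseteq\mathbb{T}=\mathbb{R}/\mathbb{Z}$ such that $\mu(A)\ge 1/2-\epsilon$, where $\mu$ is the Haar probability measure on $\mathbb{T}$, and $A$ is $(c_i,c_j)$-free for every edge $ij$ in $\Gamma$.
   Context: Non-zero integers $c_1,\dots,c_d$ are multiplicatively independent if whenever $c_1^{k_1}\cdots c_d^{k_d}=1$ with $k_i\in\mathbb{Z}$, we have $k_i=0$ for every $i$. For non-zero integers $a,b$, a Borel set $A\subseteq\mathbb{T}$ is $(a,b)$-free if there are no solutions $(x_1,x_2)\in A^2$ to the equation $a x_1=b x_2$ in $\mathbb{T}$. *)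

theory Defs
  imports "HOL-Analysis.Analysis" "HOL-Probability.Probability_Measure" "HOL-Library.Ramsey"
begin

quotient_type torus = real / "\<lambda>x y :: real. x - y \<in> \<int>"
  morphisms rep_torus to_torus
proof (rule equivpI)
  show "reflp (\<lambda>x y :: real. x - y \<in> \<int>)"
    by (rule reflpI) simp
  show "symp (\<lambda>x y :: real. x - y \<in> \<int>)"
    by (rule sympI) (metis Ints_minus minus_diff_eq)
  show "transp (\<lambda>x y :: real. x - y \<in> \<int>)"
  proof (rule transpI)
    fix x y z :: real
    assume "x - y \<in> \<int>" "y - z \<in> \<int>"
    then have "(x - y) + (y - z) \<in> \<int>" by (rule Ints_add)
    then show "x - z \<in> \<int>" by simp
  qed
qed

instantiation torus :: ab_group_add
begin

lift_definition zero_torus :: torus is "0 :: real" .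

lift_definition plus_torus :: "torus \<Rightarrow> torus \<Rightarrow> torus" is "(+) :: real \<Rightarrow> _"
  by (metis Ints_add add_diff_add)

lift_definition uminus_torus :: "torus \<Rightarrow> torus" is "uminus :: real \<Rightarrow> _"
  by (metis Ints_minus minus_diff_minus)

lift_definition minus_torus :: "torus \<Rightarrow> torus \<Rightarrow> torus" is "(-) :: real \<Rightarrow> _"
proof -
  fix a b c d :: real
  assume "a - b \<in> \<int>" "c - d \<in> \<int>"
  then have "(a - b) - (c - d) \<in> \<int>" by (rule Ints_diff)
  then show "(a - c) - (b - d) \<in> \<int>" by (simp add: algebra_simps)
qed

instance
  by standard (transfer; simp)+

end

lift_definition int_mult :: "int \<Rightarrow> torus \<Rightarrow> torus" is "\<lambda>n x. of_int n * x"
  by (metis Ints_mult Ints_of_int right_diff_distrib)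

lemma int_mult_simps:
  "int_mult 0 x = 0" "int_mult 1 x = x"
  "int_mult (m + n) x = int_mult m x + int_mult n x"
  "int_mult (- n) x = - int_mult n x"
  by (transfer; simp add: algebra_simps)+

instantiation torus :: topological_space
begin

definition open_torus :: "torus set \<Rightarrow> bool" where
  "open_torus U \<longleftrightarrow> open (to_torus -` U)"

instance
  by standard (auto simp: open_torus_def vimage_Union)

end

lemma continuous_on_to_torus: "continuous_on UNIV to_torus"
  by (simp add: continuous_on_open_vimage open_torus_def)

lemma measurable_to_torus [measurable]: "to_torus \<in> borel_measurable borel"
  by (rule borel_measurable_continuous_onI) (rule continuous_on_to_torus)

text \<open>
  Haar probability measure, realised as the image of Lebesgue measure on the
  fundamental domain \<open>[0,1)\<close>. That this is a translation-invariant probability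
  measure is verified below.
\<close>

definition haar :: "torus measure" where
  "haar = distr (restrict_space lborel {0..<1}) borel to_torus"

lemma sets_haar [simp, measurable_cong]: "sets haar = sets borel"
  by (simp add: haar_def)

lemma space_haar [simp]: "space haar = UNIV"
  by (simp add: haar_def)

lemma emeasure_haar:
  assumes "A \<in> sets borel"
  shows "emeasure haar A = emeasure lborel (to_torus -` A \<inter> {0..<1})"
proof -
  have "to_torus \<in> measurable (restrict_space lborel {0..<1}) borel"
    by (intro measurable_restrict_space1) simp
  with assms show ?thesis
    by (simp add: haar_def emeasure_distr emeasure_restrict_space space_restrict_space)
qed

lemma prob_space_haar: "prob_space haar"
  by (rule prob_spaceI) (simp add: emeasure_haar)

lemma emeasure_haar_translate:
  assumes A: "A \<in> sets borel"
  shows "emeasure haar ((+) t -` A) = emeasure haar A"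
proof -
  have shift: "emeasure lborel ((+) a -` S) = emeasure lborel S"
    if "S \<in> sets borel" for a :: real and S
  proof -
    have "emeasure lborel S = emeasure (distr lborel borel ((+) a)) S"
      by (simp add: lborel_distr_plus)
    also have "\<dots> = emeasure lborel ((+) a -` S)"
      using that by (subst emeasure_distr) auto
    finally show ?thesis by simp
  qed
  have "\<exists>r. t = to_torus r" by (induct t rule: torus.abs_induct) blast
  then obtain r where r: "t = to_torus r" ..
  define s where "s = frac r"
  have "r - s \<in> \<int>" by (simp add: s_def frac_def)
  then have t: "t = to_torus s" by (simp add: r torus.abs_eq_iff)
  have s: "0 \<le> s" "s < 1" by (auto simp: s_def frac_lt_1)
  define B where "B = to_torus -` A"
  have B [measurable]: "B \<in> sets borel"
    unfolding B_def using measurable_sets[OF measurable_to_torus A] by simp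
  have "to_torus (1 + x) = to_torus x" for x
    by (simp add: torus.abs_eq_iff)
  then have per: "1 + x \<in> B \<longleftrightarrow> x \<in> B" for x by (simp add: B_def)
  have "(+) t -` A \<in> sets borel"
  proof -
    have cont: "continuous_on UNIV ((+) t)"
    proof (subst continuous_on_open_vimage, simp, intro allI impI)
      fix U :: "torus set"
      assume "open U"
      then have "open (to_torus -` U)" by (simp add: open_torus_def)
      moreover have "continuous_on UNIV ((+) s)" by (intro continuous_intros)
      ultimately have "open ((+) s -` (to_torus -` U))" by (rule open_vimage)
      moreover have "(+) s -` (to_torus -` U) = to_torus -` ((+) t -` U)"
        by (auto simp: t plus_torus.abs_eq)
      ultimately show "open ((+) t -` U \<inter> UNIV)" by (simp add: open_torus_def)
    qed
    from measurable_sets[OF borel_measurable_continuous_onI[OF cont] A]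
    show ?thesis by simp
  qed
  then have "emeasure haar ((+) t -` A)
      = emeasure lborel (to_torus -` ((+) t -` A) \<inter> {0..<1})"
    by (rule emeasure_haar)
  also have "to_torus -` ((+) t -` A) \<inter> {0..<1} = (+) s -` (B \<inter> {s..<s + 1})"
    by (auto simp: B_def t plus_torus.abs_eq)
  also have "emeasure lborel \<dots> = emeasure lborel (B \<inter> {s..<s + 1})"
    by (rule shift) simp
  also have "B \<inter> {s..<s + 1} = (B \<inter> {s..<1}) \<union> (B \<inter> {1..<s + 1})"
    using s by auto
  also have "emeasure lborel \<dots> = emeasure lborel (B \<inter> {s..<1}) + emeasure lborel (B \<inter> {1..<s + 1})"
    by (rule plus_emeasure[symmetric]) auto
  also have "emeasure lborel (B \<inter> {1..<s + 1}) = emeasure lborel ((+) 1 -` (B \<inter> {1..<s + 1}))"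
    by (rule shift[symmetric]) simp
  also have "(+) 1 -` (B \<inter> {1..<s + 1}) = B \<inter> {0..<s}"
    by (auto simp: per)
  also have "emeasure lborel (B \<inter> {s..<1}) + emeasure lborel (B \<inter> {0..<s})
      = emeasure lborel ((B \<inter> {s..<1}) \<union> (B \<inter> {0..<s}))"
    by (rule plus_emeasure) auto
  also have "(B \<inter> {s..<1}) \<union> (B \<inter> {0..<s}) = B \<inter> {0..<1}"
    using s by auto
  also have "emeasure lborel \<dots> = emeasure haar A"
    using A by (simp add: emeasure_haar B_def)
  finally show ?thesis .
qed

text \<open>Integer exponents may be negative, so the product is taken in the rationals.\<close>

definition mult_independent :: "'i set \<Rightarrow> ('i \<Rightarrow> int) \<Rightarrow> bool" where
  "mult_independent I c \<longleftrightarrow>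
    (\<forall>k :: 'i \<Rightarrow> int. (\<Prod>i\<in>I. (of_int (c i) :: rat) powi k i) = 1 \<longrightarrow> (\<forall>i\<in>I. k i = 0))"

definition free_set :: "int \<Rightarrow> int \<Rightarrow> torus set \<Rightarrow> bool" where
  "free_set a b A \<longleftrightarrow> \<not> (\<exists>x\<^sub>1\<in>A. \<exists>x\<^sub>2\<in>A. int_mult a x\<^sub>1 = int_mult b x\<^sub>2)"

text \<open>A simple graph on the vertex set \<open>V\<close> is given by its set \<open>E\<close> of two-element edges.\<close>

definition simple_graph :: "'v set \<Rightarrow> 'v set set \<Rightarrow> bool" where
  "simple_graph V E \<longleftrightarrow> E \<subseteq> [V]\<^bsup>2\<^esup>"

definition bipartite_graph :: "'v set \<Rightarrow> 'v set set \<Rightarrow> bool" where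
  "bipartite_graph V E \<longleftrightarrow> simple_graph V E \<and>
    (\<exists>X Y. X \<union> Y = V \<and> X \<inter> Y = {} \<and> (\<forall>e\<in>E. \<exists>x\<in>X. \<exists>y\<in>Y. e = {x, y}))"

end

(* A measurable f : T -> bool with f(c_i x) = f(x) xor w_i, where w_i records whether i and 0 lie in
   different classes of the bipartition, would solve the problem exactly, both level sets being free
   for all edges. It suffices to have such an f up to an exceptional set of small measure, which is
   removed from the larger level set.
   To get f, take a large box S of monomials in c_1, ..., c_d, which is almost invariant under
   multiplication by each c_i, and a random permutation sigma of the Q arcs of length 1/Q. Let f(x) be
   the parity of the total exponent of the c_i with w_i = 1 in the monomial s in S that minimises
   sigma(arc of s x). For Q large and most x the
   points s x lie in different arcs, so every s is equally likely to be the minimiser; the minimiser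
   over S u c_i S then lies in S n c_i S with high probability, and in that case f(x) and f(c_i x)
   are read off from the same point. *)

theory Submission
  imports Defs "HOL-Combinatorics.Permutations"
begin

section \<open>Measurability on the torus\<close>

text \<open>\<open>rep_torus\<close> picks an unspecified representative. Lifting
  \<open>frac\<close> instead gives an explicit coordinate with values in [0,1), whose measurability
  can be proved.\<close>

lift_definition torus_frac :: "torus \<Rightarrow> real" is frac
proof -
  fix x y :: real
  assume "x - y \<in> \<int>"
  then obtain n where "x - y = of_int n" by (auto elim: Ints_cases)
  then have "x = y + of_int n" by simp
  then show "frac x = frac y" by (simp add: frac_def)
qed

lemma torus_frac_bounds: "0 \<le> torus_frac t" "torus_frac t < 1"
  by (transfer; simp add: frac_lt_1)+

text \<open>\<open>frac\<close> is lower semicontinuous: its only jumps are the drops to 0 at the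
  integers. Hence its strict superlevel sets are open, and they are invariant under integer
  shifts.\<close>

lemma torus_frac_measurable [measurable]: "torus_frac \<in> borel_measurable borel"
proof (rule borel_measurableI_greater)
  fix a :: real
  have "{t. torus_frac t > a} \<in> sets borel"
  proof (cases "a < 0")
    case True
    then have "{t. torus_frac t > a} = UNIV"
      using torus_frac_bounds(1) by (auto intro: less_le_trans)
    then show ?thesis by simp
  next
    case False
    have "frac x > a \<longleftrightarrow> (\<exists>n::int. of_int n + a < x \<and> x < of_int n + 1)" for x
    proof
      assume "frac x > a"
      then show "\<exists>n::int. of_int n + a < x \<and> x < of_int n + 1"
        by (intro exI[of _ "\<lfloor>x\<rfloor>"]) (auto simp: frac_def)
    next
      assume "\<exists>n::int. of_int n + a < x \<and> x < of_int n + 1"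
      then obtain n :: int where n: "of_int n + a < x" "x < of_int n + 1" by blast
      with False have "\<lfloor>x\<rfloor> = n" by (intro floor_unique) auto
      with n show "frac x > a" by (simp add: frac_def)
    qed
    then have "to_torus -` {t. torus_frac t > a} = (\<Union>n::int. {of_int n + a <..< of_int n + 1})"
      by (auto simp: torus_frac.abs_eq)
    then have "open (to_torus -` {t. torus_frac t > a})"
      by (simp add: open_UN)
    then show ?thesis
      by (intro borel_open) (simp add: open_torus_def)
  qed
  then show "{t \<in> space borel. a < torus_frac t} \<in> sets borel" by simp
qed

lemma int_mult_measurable [measurable]: "int_mult n \<in> measurable borel borel"
proof (rule borel_measurable_continuous_onI)
  show "continuous_on UNIV (int_mult n)"
  proof (subst continuous_on_open_vimage, simp, intro allI impI)
    fix U :: "torus set"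
    assume "open U"
    then have "open (to_torus -` U)" by (simp add: open_torus_def)
    moreover have "continuous_on UNIV (\<lambda>x. of_int n * x :: real)" by (intro continuous_intros)
    ultimately have "open ((\<lambda>x. of_int n * x) -` (to_torus -` U))" by (rule open_vimage)
    moreover have "(\<lambda>x. of_int n * x) -` (to_torus -` U) = to_torus -` (int_mult n -` U)"
      by (auto simp: int_mult.abs_eq)
    ultimately show "open (int_mult n -` U \<inter> UNIV)" by (simp add: open_torus_def)
  qed
qed

lemma int_mult_int_mult: "int_mult a (int_mult b x) = int_mult (b * a) x"
  by transfer (simp add: mult_ac)

section \<open>Partition of the torus into equal arcs\<close>

text \<open>Index of the half-open arc [i/Q, (i+1)/Q) that contains \<open>t\<close>. With finitely
  many labels, a random order on the arcs amounts to counting permutations of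
  \<open>{..<Q}\<close>.\<close>

definition arc_index :: "nat \<Rightarrow> torus \<Rightarrow> nat" where
  "arc_index Q t = nat \<lfloor>real Q * torus_frac t\<rfloor>"

lemma arc_index_measurable [measurable]: "arc_index Q \<in> measurable borel (count_space UNIV)"
  unfolding arc_index_def by measurable

text \<open>Indices take countably many values, so the set is a countable union of intersections of
  fibres. Leaving \<open>P\<close> arbitrary covers both coincidence of arcs and comparison of arcs
  after a permutation.\<close>

lemma arc_index_relation_measurable:
  "{x. P (arc_index Q (int_mult s x)) (arc_index Q (int_mult t x))} \<in> sets borel"
proof -
  have fib: "{x. arc_index Q (int_mult s x) = i} \<in> sets borel" for s i
  proof -
    have "(\<lambda>x. arc_index Q (int_mult s x)) \<in> measurable borel (count_space UNIV)" by measurable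
    from measurable_sets[OF this, of "{i}"] show ?thesis
      by (simp add: vimage_def)
  qed
  have "{x. P (arc_index Q (int_mult s x)) (arc_index Q (int_mult t x))}
    = (\<Union>(i, j)\<in>{(i, j). P i j}. {x. arc_index Q (int_mult s x) = i} \<inter> {x. arc_index Q (int_mult t x) = j})"
    by auto
  also have "\<dots> \<in> sets borel"
    by (intro sets.countable_UN'') (auto intro: fib)
  finally show ?thesis .
qed

lemma arc_index_less: "Q > 0 \<Longrightarrow> arc_index Q t < Q"
  using torus_frac_bounds[of t]
  by (simp add: arc_index_def nat_less_iff floor_less_iff)

text \<open>Fractional parts with the same index are less than 1/Q apart, and their difference is
  that of \<open>s * x\<close> and \<open>t * x\<close> up to an integer.\<close>

lemma arc_index_eq_near_int:
  assumes "Q > 0" and "arc_index Q (int_mult s (to_torus x)) = arc_index Q (int_mult t (to_torus x))"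
  shows "\<exists>j::int. \<bar>of_int (s - t) * x - of_int j\<bar> < 1 / Q"
proof -
  let ?a = "frac (of_int s * x)" and ?b = "frac (of_int t * x)"
  have "\<lfloor>real Q * ?a\<rfloor> = \<lfloor>real Q * ?b\<rfloor>"
    using assms(2) by (simp add: arc_index_def int_mult.abs_eq torus_frac.abs_eq eq_nat_nat_iff)
  then have "\<bar>real Q * ?a - real Q * ?b\<bar> < 1" by linarith
  then have "\<bar>real Q * (?a - ?b)\<bar> < 1" by (simp only: right_diff_distrib)
  then have "real Q * \<bar>?a - ?b\<bar> < 1" by (simp only: abs_mult abs_of_nat)
  then have "\<bar>?a - ?b\<bar> < 1 / Q" using assms(1) by (simp add: mult_imp_less_div_pos mult.commute)
  then show ?thesis
    by (intro exI[of _ "\<lfloor>of_int s * x\<rfloor> - \<lfloor>of_int t * x\<rfloor>"])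
      (simp add: frac_def algebra_simps)
qed

text \<open>With k = s - t, the number k x is within 1/Q of an integer j, so x is within 1/(Q |k|)
  \<le> 1/Q of j/k. For x in [0,1) only the j with |j| \<le> |k| + 1 can occur, and each contributes
  an interval of length 2/Q. The bound is crude; what matters is its decay in \<open>Q\<close> for
  fixed \<open>s\<close> and \<open>t\<close>.\<close>

lemma measure_same_arc_index_le:
  assumes Q: "Q > 0" and st: "s \<noteq> t"
  shows "measure haar {x. arc_index Q (int_mult s x) = arc_index Q (int_mult t x)}
    \<le> real (card {-\<bar>s-t\<bar>-1..\<bar>s-t\<bar>+1}) * (2 / Q)"
proof -
  define k where "k = s - t"
  define J where "J = {-\<bar>k\<bar>-1..\<bar>k\<bar>+1}"
  define V where "V = {x. arc_index Q (int_mult s x) = arc_index Q (int_mult t x)}"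
  have k: "\<bar>of_int k :: real\<bar> \<ge> 1" using st unfolding k_def by linarith
  then have k0: "(of_int k :: real) \<noteq> 0" by auto
  have V: "V \<in> sets borel" unfolding V_def by (rule arc_index_relation_measurable)
  have sub: "to_torus -` V \<inter> {0..<1} \<subseteq> (\<Union>j\<in>J. cball (of_int j / of_int k) (1 / Q))"
  proof
    fix x assume x: "x \<in> to_torus -` V \<inter> {0..<1}"
    then obtain j :: int where j: "\<bar>of_int k * x - of_int j\<bar> < 1 / Q"
      using arc_index_eq_near_int[OF Q, of s x t] by (auto simp: V_def k_def)
    have "1 / Q \<le> (1::real)" using Q by simp
    moreover have "\<bar>of_int k * x\<bar> \<le> \<bar>of_int k\<bar>"
      using x by (auto simp: abs_mult intro!: mult_left_le)
    ultimately have "\<bar>of_int j\<bar> < \<bar>of_int k :: real\<bar> + 1" using j by linarith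
    then have "j \<in> J" unfolding J_def by (simp; linarith)
    moreover have "x \<in> cball (of_int j / of_int k) (1 / Q)"
    proof -
      have "of_int j / of_int k - x = (of_int j - of_int k * x) / of_int k"
        using k0 by (simp add: field_simps)
      then have "\<bar>of_int j / of_int k - x\<bar> = \<bar>of_int k * x - of_int j\<bar> / \<bar>of_int k\<bar>"
        by (simp add: abs_minus_commute)
      also have "\<dots> \<le> \<bar>of_int k * x - of_int j\<bar>"
        using k0 mult_right_mono[OF k, of "\<bar>of_int k * x - of_int j\<bar>"]
        by (simp add: divide_le_eq mult.commute)
      finally show ?thesis using j by (simp add: dist_real_def)
    qed
    ultimately show "x \<in> (\<Union>j\<in>J. cball (of_int j / of_int k) (1 / Q))" by blast
  qed
  have "emeasure haar V = emeasure lborel (to_torus -` V \<inter> {0..<1})"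
    using V by (rule emeasure_haar)
  also have "\<dots> \<le> emeasure lborel (\<Union>j\<in>J. cball (of_int j / of_int k :: real) (1 / Q))"
    using sub by (intro emeasure_mono) (auto simp: J_def)
  also have "\<dots> \<le> (\<Sum>j\<in>J. emeasure lborel (cball (of_int j / of_int k :: real) (1 / Q)))"
    by (intro emeasure_subadditive_finite) (auto simp: J_def)
  also have "\<dots> = (\<Sum>j\<in>J. ennreal (2 / Q))"
    by (intro sum.cong refl) (simp add: cball_eq_atLeastAtMost)
  also have "\<dots> = ennreal (real (card J) * (2 / Q))"
    by (simp only: sum_constant ennreal_of_nat_eq_real_of_nat ennreal_mult'' of_nat_0_le_iff divide_nonneg_nonneg zero_le_numeral)
  finally show ?thesis
    unfolding measure_def V_def J_def k_def by (intro enn2real_leI) auto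
qed

text \<open>Union bound over the finitely many pairs of distinct elements of
  \<open>U\<close>.\<close>

lemma measure_not_inj_arc_index_tendsto_0:
  assumes "finite U"
  shows "(\<lambda>Q. measure haar {x. \<not> inj_on (\<lambda>s. arc_index Q (int_mult s x)) U}) \<longlonglongrightarrow> 0"
proof -
  interpret prob_space haar by (rule prob_space_haar)
  define E where "E = (\<lambda>Q (s, t). {x. arc_index Q (int_mult s x) = arc_index Q (int_mult t x)})"
  define P where "P = {(s, t). s \<in> U \<and> t \<in> U \<and> s \<noteq> t}"
  have "P \<subseteq> U \<times> U" by (auto simp: P_def)
  then have P: "finite P" using assms by (meson finite_SigmaI finite_subset)
  have E [measurable]: "E Q p \<in> sets borel" for Q p
    unfolding E_def by (cases p) (simp add: arc_index_relation_measurable)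
  have eq: "{x. \<not> inj_on (\<lambda>s. arc_index Q (int_mult s x)) U} = (\<Union>p\<in>P. E Q p)" for Q
    by (auto simp: inj_on_def P_def E_def)
  have "(\<lambda>Q. measure haar (E Q p)) \<longlonglongrightarrow> 0" if pP: "p \<in> P" for p
  proof -
    obtain s t where p: "p = (s, t)" "s \<noteq> t" using pP by (auto simp: P_def)
    let ?C = "real (card {-\<bar>s-t\<bar>-1..\<bar>s-t\<bar>+1})"
    have "(\<lambda>Q. ?C * (2 / real Q)) \<longlonglongrightarrow> ?C * 0"
      by (intro tendsto_mult tendsto_const lim_const_over_n)
    then have lim: "(\<lambda>Q. ?C * (2 / real Q)) \<longlonglongrightarrow> 0" by simp
    show ?thesis
    proof (rule tendsto_sandwich[OF _ _ tendsto_const lim])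
      show "\<forall>\<^sub>F Q in sequentially. measure haar (E Q p) \<le> ?C * (2 / real Q)"
        using eventually_gt_at_top[of 0]
      proof eventually_elim
        fix Q :: nat assume "0 < Q"
        from measure_same_arc_index_le[OF this p(2)]
        show "measure haar (E Q p) \<le> ?C * (2 / real Q)" by (simp only: E_def p prod.case)
      qed
    qed auto
  qed
  then have "(\<lambda>Q. \<Sum>p\<in>P. measure haar (E Q p)) \<longlonglongrightarrow> 0"
    by (rule tendsto_null_sum)
  then show ?thesis
  proof (rule tendsto_sandwich[OF _ _ tendsto_const, rotated 2])
    show "\<forall>\<^sub>F Q in sequentially. measure haar {x. \<not> inj_on (\<lambda>s. arc_index Q (int_mult s x)) U}
        \<le> (\<Sum>p\<in>P. measure haar (E Q p))"
      unfolding eq using P by (intro always_eventually allI measure_UNION_le) auto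
  qed auto
qed

section \<open>Minima of random labellings\<close>

text \<open>Strictness makes the minimiser unique for every \<open>g\<close>, with ties allowed
  elsewhere. Injectivity enters only in the proof that a minimiser exists.\<close>

definition strict_min :: "('a \<Rightarrow> nat) \<Rightarrow> 'a set \<Rightarrow> 'a \<Rightarrow> bool" where
  "strict_min g K k \<longleftrightarrow> k \<in> K \<and> (\<forall>m\<in>K - {k}. g k < g m)"

lemma strict_min_unique: "strict_min g K k \<Longrightarrow> strict_min g K l \<Longrightarrow> k = l"
  unfolding strict_min_def by (metis DiffI order_less_asym singletonD)

lemma strict_min_subset: "strict_min g K k \<Longrightarrow> k \<in> L \<Longrightarrow> L \<subseteq> K \<Longrightarrow> strict_min g L k"
  unfolding strict_min_def by blast

lemma strict_min_exists:
  assumes "finite K" "K \<noteq> {}" "inj_on g K"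
  shows "\<exists>k. strict_min g K k"
proof -
  obtain k where k: "k \<in> K" "\<And>m. m \<in> K \<Longrightarrow> g k \<le> g m"
    using ex_min_if_finite[of "g ` K"] assms by (fastforce simp: not_less)
  then have "strict_min g K k"
    using assms(3) unfolding strict_min_def inj_on_def by (metis DiffE insertI1 le_neq_implies_less)
  then show ?thesis ..
qed

lemma strict_min_reindex:
  assumes "inj_on h K" "k \<in> K"
  shows "strict_min g (h ` K) (h k) \<longleftrightarrow> strict_min (g \<circ> h) K k"
  using assms unfolding strict_min_def inj_on_def by auto

text \<open>Precomposition with the transposition of \<open>k\<close> and \<open>l\<close> is an
  injection from the first set of permutations into the second. By symmetry all elements of
  \<open>K\<close> are equally likely to be the minimiser.\<close>

lemma card_permutations_strict_min_mono:
  assumes "finite V" "k \<in> K" "l \<in> K" "K \<subseteq> V"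
  shows "card {\<sigma>. \<sigma> permutes V \<and> strict_min \<sigma> K k} \<le> card {\<sigma>. \<sigma> permutes V \<and> strict_min \<sigma> K l}"
proof (rule card_inj_on_le)
  let ?\<tau> = "Transposition.transpose k l"
  show "inj_on (\<lambda>\<sigma>. \<sigma> \<circ> ?\<tau>) {\<sigma>. \<sigma> permutes V \<and> strict_min \<sigma> K k}"
  proof (rule inj_onI)
    fix \<sigma> \<rho> assume "\<sigma> \<circ> ?\<tau> = \<rho> \<circ> ?\<tau>"
    then have "\<sigma> \<circ> ?\<tau> \<circ> ?\<tau> = \<rho> \<circ> ?\<tau> \<circ> ?\<tau>" by simp
    then show "\<sigma> = \<rho>" by (simp add: comp_assoc)
  qed
  have \<tau>: "?\<tau> permutes V" using assms by (intro permutes_swap_id) auto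
  have "strict_min (\<sigma> \<circ> ?\<tau>) K l" if "strict_min \<sigma> K k" for \<sigma>
  proof -
    have "\<sigma> (?\<tau> l) < \<sigma> (?\<tau> m)" if "m \<in> K - {l}" for m
    proof -
      have "?\<tau> m \<in> K - {k}"
        using that assms(2,3) by (cases "m = k") (auto simp: Transposition.transpose_def)
      then show ?thesis using \<open>strict_min \<sigma> K k\<close> by (simp add: strict_min_def)
    qed
    then show ?thesis using assms(3) by (simp add: strict_min_def)
  qed
  then show "(\<lambda>\<sigma>. \<sigma> \<circ> ?\<tau>) ` {\<sigma>. \<sigma> permutes V \<and> strict_min \<sigma> K k}
      \<subseteq> {\<sigma>. \<sigma> permutes V \<and> strict_min \<sigma> K l}"
    using permutes_compose[OF \<tau>] by auto
  show "finite {\<sigma>. \<sigma> permutes V \<and> strict_min \<sigma> K l}"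
    using finite_permutations[OF assms(1)] by (rule rev_finite_subset) auto
qed

text \<open>The events that a given element of \<open>K\<close> is the minimiser are disjoint and
  equally likely, so each has probability at most 1 / \<open>card K\<close>; summing over
  \<open>D\<close> gives the bound, stated free of division.\<close>

lemma card_permutations_strict_min_le:
  assumes V: "finite V" and K: "K \<subseteq> V" and D: "D \<subseteq> K"
  shows "card K * card {\<sigma>. \<sigma> permutes V \<and> (\<exists>k\<in>D. strict_min \<sigma> K k)} \<le> card D * fact (card V)"
proof -
  define E where "E k = {\<sigma>. \<sigma> permutes V \<and> strict_min \<sigma> K k}" for k
  have fin: "finite K" "finite D"
    using finite_subset[OF K V] finite_subset[OF D] by auto
  have finE: "finite (E k)" for k
    using finite_permutations[OF V] by (rule rev_finite_subset) (auto simp: E_def)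
  have each: "card K * card (E k) \<le> fact (card V)" if "k \<in> K" for k
  proof -
    have "card K * card (E k) = (\<Sum>l\<in>K. card (E k))" by simp
    also have "\<dots> \<le> (\<Sum>l\<in>K. card (E l))"
      unfolding E_def using that V K by (intro sum_mono card_permutations_strict_min_mono) auto
    also have "\<dots> = card (\<Union>l\<in>K. E l)"
    proof (rule card_UN_disjoint[symmetric])
      show "\<forall>k\<in>K. \<forall>l\<in>K. k \<noteq> l \<longrightarrow> E k \<inter> E l = {}"
        unfolding E_def by (auto dest: strict_min_unique[of _ K])
    qed (use fin finE in auto)
    also have "\<dots> \<le> card {\<sigma>. \<sigma> permutes V}"
      using finite_permutations[OF V] by (intro card_mono) (auto simp: E_def)
    also have "\<dots> = fact (card V)" using V by (simp add: card_permutations)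
    finally show ?thesis .
  qed
  have "{\<sigma>. \<sigma> permutes V \<and> (\<exists>k\<in>D. strict_min \<sigma> K k)} = (\<Union>k\<in>D. E k)"
    by (auto simp: E_def)
  then have "card K * card {\<sigma>. \<sigma> permutes V \<and> (\<exists>k\<in>D. strict_min \<sigma> K k)}
      \<le> card K * (\<Sum>k\<in>D. card (E k))"
    using card_UN_le[OF fin(2), of E] by simp
  also have "\<dots> = (\<Sum>k\<in>D. card K * card (E k))" by (rule sum_distrib_left)
  also have "\<dots> \<le> (\<Sum>k\<in>D. fact (card V))" using D by (intro sum_mono each) auto
  finally show ?thesis by simp
qed

section \<open>Approximate eigenfunctions\<close>

text \<open>Integrating the pointwise count shows that the probabilities of the \<open>A p\<close>
  have average at most \<open>b\<close>, so one of them is at most \<open>b\<close>. This replaces a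
  random permutation by a fixed one.\<close>

lemma (in prob_space) ex_prob_le_average:
  fixes b :: real
  assumes P: "finite P" "P \<noteq> {}"
    and A: "\<And>p. p \<in> P \<Longrightarrow> A p \<in> events"
    and le: "\<And>x. x \<in> space M \<Longrightarrow> real (card {p\<in>P. x \<in> A p}) \<le> b * card P"
  shows "\<exists>p\<in>P. prob (A p) \<le> b"
proof (rule ccontr)
  assume "\<not> ?thesis"
  then have gt: "\<And>p. p \<in> P \<Longrightarrow> b < prob (A p)" by (auto simp: not_le)
  have "b * card P = (\<Sum>p\<in>P. b)" by simp
  also have "\<dots> < (\<Sum>p\<in>P. prob (A p))" using P gt by (intro sum_strict_mono)
  also have "\<dots> = (\<Sum>p\<in>P. expectation (indicator (A p)))" using A by simp
  also have "\<dots> = expectation (\<lambda>x. \<Sum>p\<in>P. indicator (A p) x)"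
    using A by (intro Bochner_Integration.integral_sum[symmetric]) (auto simp: emeasure_eq_measure)
  also have "\<dots> \<le> expectation (\<lambda>x. b * card P)"
  proof (intro integral_mono)
    show "integrable M (\<lambda>x. \<Sum>p\<in>P. indicator (A p) x :: real)"
      using A by (intro Bochner_Integration.integrable_sum) (auto simp: emeasure_eq_measure)
    fix x assume x: "x \<in> space M"
    have "(\<Sum>p\<in>P. indicator (A p) x :: real) = (\<Sum>p\<in>P. if x \<in> A p then 1 else 0)"
      by (intro sum.cong) auto
    also have "\<dots> = (\<Sum>p\<in>{p\<in>P. x \<in> A p}. 1)"
      using P(1) by (rule sum.inter_filter[symmetric])
    finally have "(\<Sum>p\<in>P. indicator (A p) x :: real) = real (card {p\<in>P. x \<in> A p})"
      by simp
    then show "(\<Sum>p\<in>P. indicator (A p) x) \<le> b * card P" using le[OF x] by simp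
  qed simp
  also have "\<dots> = b * card P" by (simp add: prob_space)
  finally show False by simp
qed

text \<open>Multiplication by a non-zero \<open>a\<close> is injective, so \<open>S\<close> and its
  image have equal size and the two one-sided differences do as well.\<close>

lemma card_sym_diff_mult_le:
  fixes S :: "int set"
  assumes "finite S" "a \<noteq> 0"
  shows "card ((S - (*) a ` S) \<union> ((*) a ` S - S)) \<le> 2 * card (S - (*) a ` S)"
proof -
  let ?T = "(*) a ` S"
  have T: "card ?T = card S" using assms(2) by (intro card_image) (auto simp: inj_on_def)
  have "card (?T - S) = card ?T - card (?T \<inter> S)" using assms(1) by (intro card_Diff_subset_Int) auto
  moreover have "card (S - ?T) = card S - card (S \<inter> ?T)" using assms(1) by (intro card_Diff_subset_Int) auto
  ultimately have "card (?T - S) = card (S - ?T)" using T by (simp add: Int_commute)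
  then show ?thesis using card_Un_le[of "S - ?T" "?T - S"] by simp
qed

text \<open>Reading truth values as signs, \<open>f\<close> is nearly an eigenfunction of
  composition with x \<mapsto> c_i x, with eigenvalue -1 exactly when \<open>w i\<close>. The error
  \<open>2 * \<delta> * card I\<close> bounds the chance that a minimiser over the union of
  \<open>S\<close> and its multiple misses their intersection, summed over \<open>I\<close>; \<eta>
  bounds the set where two labels coincide.\<close>

lemma ex_approximate_eigenfunction:
  fixes S :: "int set" and c :: "'i \<Rightarrow> int" and \<delta> \<eta> :: real
  assumes I: "finite I" and S: "finite S" "S \<noteq> {}"
    and c: "\<And>i. i \<in> I \<Longrightarrow> c i \<noteq> 0"
    and \<xi>: "\<And>i s. i \<in> I \<Longrightarrow> s \<in> S \<Longrightarrow> \<xi> (c i * s) = (\<xi> s \<noteq> w i)"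
    and folner: "\<And>i. i \<in> I \<Longrightarrow> real (card (S - (*) (c i) ` S)) \<le> \<delta> * card S"
    and \<eta>: "\<eta> > 0"
  shows "\<exists>f. {x. f x} \<in> sets borel \<and>
    measure haar {x. \<exists>i\<in>I. f (int_mult (c i) x) \<noteq> (f x \<noteq> w i)} \<le> 2 * \<delta> * card I + \<eta>"
proof -
  interpret prob_space haar by (rule prob_space_haar)
  define K where "K i = S \<union> (*) (c i) ` S" for i
  define U where "U = (\<Union>i\<in>I. K i)"
  define D where "D i = (S - (*) (c i) ` S) \<union> ((*) (c i) ` S - S)" for i
  have finU: "finite U" and finK: "\<And>i. finite (K i)" using I S by (auto simp: U_def K_def)
  have "\<forall>\<^sub>F Q in sequentially. measure haar {x. \<not> inj_on (\<lambda>s. arc_index Q (int_mult s x)) U} < \<eta>"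
    using order_tendstoD(2)[OF measure_not_inj_arc_index_tendsto_0[OF finU] \<eta>] .
  then have "\<forall>\<^sub>F Q in sequentially. Q > 0 \<and> measure haar {x. \<not> inj_on (\<lambda>s. arc_index Q (int_mult s x)) U} < \<eta>"
    using eventually_gt_at_top[of 0] by eventually_elim simp
  then obtain Q where Q: "Q > 0"
    and \<eta>': "measure haar {x. \<not> inj_on (\<lambda>s. arc_index Q (int_mult s x)) U} < \<eta>"
    by (auto simp: eventually_sequentially)
  define \<kappa> where "\<kappa> x s = arc_index Q (int_mult s x)" for x s
  define H where "H = {x. \<not> inj_on (\<kappa> x) U}"
  define P where "P = {\<sigma>. \<sigma> permutes {..<Q}}"
  \<comment> \<open>Points of \<open>H\<close> are removed because the minimiser need not be
    equidistributed where labels collide. Their measure is accounted for separately.\<close>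
  define N where "N \<sigma> = {x. \<exists>i\<in>I. \<not> (\<exists>s\<in>S \<inter> (*) (c i) ` S. strict_min (\<sigma> \<circ> \<kappa> x) (K i) s)} - H" for \<sigma>
  \<comment> \<open>If ties leave no strict minimiser, the value defaults to
    \<open>False\<close>.\<close>
  define f where "f \<sigma> x = (\<exists>s\<in>S. \<xi> s \<and> strict_min (\<sigma> \<circ> \<kappa> x) S s)" for \<sigma> x
  have P: "finite P" "P \<noteq> {}" "card P = fact Q"
    by (auto simp: P_def finite_permutations card_permutations intro: permutes_id)
  have meas_less: "{x. \<sigma> (\<kappa> x s) < \<sigma> (\<kappa> x t)} \<in> sets borel" for \<sigma> :: "nat \<Rightarrow> nat" and s t
    unfolding \<kappa>_def by (rule arc_index_relation_measurable)
  have meas_min: "{x. strict_min (\<sigma> \<circ> \<kappa> x) L s} \<in> sets borel" if "finite L" for \<sigma> L s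
  proof -
    have "{x. strict_min (\<sigma> \<circ> \<kappa> x) L s}
      = (if s \<in> L then - (\<Union>t\<in>L-{s}. - {x. \<sigma> (\<kappa> x s) < \<sigma> (\<kappa> x t)}) else {})"
      by (auto simp: strict_min_def)
    also have "\<dots> \<in> sets borel"
    proof -
      have "- (\<Union>t\<in>L-{s}. - {x. \<sigma> (\<kappa> x s) < \<sigma> (\<kappa> x t)}) \<in> sets borel"
        using that by (intro borel_comp sets.finite_UN meas_less) auto
      then show ?thesis by simp
    qed
    finally show ?thesis .
  qed
  have H: "H \<in> sets borel"
  proof -
    have "H = (\<Union>s\<in>U. \<Union>t\<in>U - {s}. {x. \<kappa> x s = \<kappa> x t})"
      by (auto simp: H_def inj_on_def)
    also have "\<dots> \<in> sets borel"
      unfolding \<kappa>_def using finU by (intro sets.finite_UN) (auto intro: arc_index_relation_measurable)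
    finally show ?thesis .
  qed
  have N: "N \<sigma> \<in> sets borel" for \<sigma>
  proof -
    have "N \<sigma> = (\<Union>i\<in>I. UNIV - (\<Union>s\<in>S \<inter> (*) (c i) ` S. {x. strict_min (\<sigma> \<circ> \<kappa> x) (K i) s})) - H"
      unfolding N_def by blast
    also have "\<dots> \<in> sets borel"
      using I S(1) H finK by (intro sets.Diff sets.finite_UN meas_min) auto
    finally show ?thesis .
  qed
  have f: "{x. f \<sigma> x} \<in> sets borel" for \<sigma>
  proof -
    have "{x. f \<sigma> x} = (\<Union>s\<in>{s\<in>S. \<xi> s}. {x. strict_min (\<sigma> \<circ> \<kappa> x) S s})"
      by (auto simp: f_def)
    also have "\<dots> \<in> sets borel" using S(1) by (intro sets.finite_UN meas_min) auto
    finally show ?thesis .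
  qed
  have f_eq: "f \<sigma> x = \<xi> s" if "s \<in> S" "strict_min (\<sigma> \<circ> \<kappa> x) S s" for \<sigma> x s
  proof
    assume "f \<sigma> x"
    then obtain t where t: "\<xi> t" "strict_min (\<sigma> \<circ> \<kappa> x) S t" by (auto simp: f_def)
    with strict_min_unique[OF t(2) that(2)] show "\<xi> s" by simp
  next
    assume "\<xi> s"
    with that show "f \<sigma> x" unfolding f_def by (intro bexI conjI)
  qed
  have count: "real (card {\<sigma>\<in>P. x \<in> N \<sigma>}) \<le> (2 * \<delta> * card I) * card P" for x
  proof (cases "x \<in> H")
    case True
    then have none: "{\<sigma>\<in>P. x \<in> N \<sigma>} = {}" by (auto simp: N_def)
    \<comment> \<open>The count is zero here, so only the sign of the right-hand side is at issue.
      The Folner bound gives \<delta> \<ge> 0 if \<open>I\<close> is non-empty, and otherwise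
      \<open>card I\<close> is 0.\<close>
    have "0 \<le> \<delta>" if ne: "I \<noteq> {}"
    proof -
      obtain i where "i \<in> I" using ne by blast
      from folner[OF this] have "0 \<le> \<delta> * card S" by (rule order_trans[rotated]) simp
      moreover have "card S > 0" using S by (simp add: card_gt_0_iff)
      ultimately show ?thesis by (simp add: zero_le_mult_iff)
    qed
    then have "0 \<le> 2 * \<delta> * card I" by (cases "I = {}") auto
    then have "0 \<le> (2 * \<delta> * card I) * card P" by (rule mult_nonneg_nonneg) simp
    then show ?thesis unfolding none by simp
  next
    case False
    then have inj: "inj_on (\<kappa> x) (K i)" if "i \<in> I" for i
      using that by (auto simp: H_def U_def intro: inj_on_subset)
    \<comment> \<open>The bad event for \<open>i\<close>, transported to arc labels so that
      permutations of \<open>{..<Q}\<close> can be counted; \<open>\<kappa> x\<close> is injective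
      on \<open>K i\<close>, so no cardinality changes.\<close>
    define Z where "Z i = {\<sigma>. \<sigma> permutes {..<Q} \<and> (\<exists>k\<in>\<kappa> x ` D i. strict_min \<sigma> (\<kappa> x ` K i) k)}" for i
    have Z: "real (card (Z i)) \<le> 2 * \<delta> * card P" if i: "i \<in> I" for i
    proof -
      have "card (\<kappa> x ` K i) * card (Z i) \<le> card (\<kappa> x ` D i) * fact (card {..<Q})"
        unfolding Z_def using arc_index_less[OF Q]
        by (intro card_permutations_strict_min_le) (auto simp: \<kappa>_def K_def D_def)
      also have "card (\<kappa> x ` K i) = card (K i)" using inj[OF i] by (rule card_image)
      also have "card (\<kappa> x ` D i) = card (D i)"
        using inj[OF i] by (intro card_image) (auto simp: K_def D_def intro: inj_on_subset)
      finally have "card (K i) * card (Z i) \<le> card (D i) * card P" using P by simp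
      then have 1: "real (card (K i)) * card (Z i) \<le> real (card (D i)) * card P"
        by (metis of_nat_le_iff of_nat_mult)
      have "real (card (D i)) \<le> 2 * real (card (S - (*) (c i) ` S))"
        using card_sym_diff_mult_le[OF S(1) c[OF i]] unfolding D_def by linarith
      also have "\<dots> \<le> 2 * (\<delta> * card S)" using folner[OF i] by simp
      also have "\<dots> \<le> 2 * (\<delta> * card (K i))"
      proof -
        have "0 \<le> \<delta> * card S" using folner[OF i] by (rule order_trans[rotated]) simp
        moreover have "card S > 0" using S by (simp add: card_gt_0_iff)
        ultimately have "0 \<le> \<delta>" by (simp add: zero_le_mult_iff)
        moreover have "card S \<le> card (K i)" using finK by (intro card_mono) (auto simp: K_def)
        ultimately show ?thesis by (simp add: mult_left_mono)
      qed
      finally have "real (card (D i)) * card P \<le> 2 * (\<delta> * card (K i)) * card P"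
        by (rule mult_right_mono) simp
      with 1 have "real (card (K i)) * card (Z i) \<le> real (card (K i)) * (2 * \<delta> * card P)"
        by (simp add: mult_ac)
      moreover have "card (K i) > 0" using S finK by (auto simp: card_gt_0_iff K_def)
      ultimately show ?thesis by simp
    qed
    \<comment> \<open>Since the labels are distinct, a minimiser over \<open>K i\<close> exists. If
      it is not in the intersection, it lies in the symmetric difference \<open>D i\<close>.\<close>
    have "{\<sigma>\<in>P. x \<in> N \<sigma>} \<subseteq> (\<Union>i\<in>I. Z i)"
    proof
      fix \<sigma> assume \<sigma>: "\<sigma> \<in> {\<sigma>\<in>P. x \<in> N \<sigma>}"
      then obtain i where i: "i \<in> I" and none: "\<And>s. s \<in> S \<inter> (*) (c i) ` S \<Longrightarrow> \<not> strict_min (\<sigma> \<circ> \<kappa> x) (K i) s"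
        by (auto simp: N_def)
      have "inj \<sigma>" using \<sigma> by (auto simp: P_def intro: permutes_inj)
      then have "inj_on (\<sigma> \<circ> \<kappa> x) (K i)"
        using inj[OF i] by (intro comp_inj_on) (auto intro: inj_on_subset)
      then obtain s where s: "strict_min (\<sigma> \<circ> \<kappa> x) (K i) s"
        using strict_min_exists[OF finK] S by (auto simp: K_def)
      then have sK: "s \<in> K i" by (simp add: strict_min_def)
      then have "s \<in> D i" using none s by (auto simp: K_def D_def)
      moreover have "strict_min \<sigma> (\<kappa> x ` K i) (\<kappa> x s)"
        using s sK inj[OF i] by (simp add: strict_min_reindex)
      ultimately show "\<sigma> \<in> (\<Union>i\<in>I. Z i)" using \<sigma> i by (auto simp: Z_def P_def)
    qed
    moreover have finZ: "finite (Z i)" for i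
      using P(1) by (rule rev_finite_subset) (auto simp: Z_def P_def)
    ultimately have "card {\<sigma>\<in>P. x \<in> N \<sigma>} \<le> card (\<Union>i\<in>I. Z i)" using I by (intro card_mono) auto
    also have "\<dots> \<le> (\<Sum>i\<in>I. card (Z i))" using I by (rule card_UN_le)
    finally have "real (card {\<sigma>\<in>P. x \<in> N \<sigma>}) \<le> (\<Sum>i\<in>I. real (card (Z i)))"
      by (metis of_nat_le_iff of_nat_sum)
    also have "\<dots> \<le> (\<Sum>i\<in>I. 2 * \<delta> * card P)" by (intro sum_mono Z)
    finally show ?thesis by (simp add: mult_ac)
  qed
  obtain \<sigma> where \<sigma>: "\<sigma> \<in> P" "prob (N \<sigma>) \<le> 2 * \<delta> * card I"
    using ex_prob_le_average[OF P(1,2), of N "2 * \<delta> * card I"] N count by auto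
  have "{x. \<exists>i\<in>I. f \<sigma> (int_mult (c i) x) \<noteq> (f \<sigma> x \<noteq> w i)} \<subseteq> N \<sigma> \<union> H"
  proof (rule subsetI, rule ccontr)
    fix x assume "x \<in> {x. \<exists>i\<in>I. f \<sigma> (int_mult (c i) x) \<noteq> (f \<sigma> x \<noteq> w i)}"
    then obtain i where i: "i \<in> I" and ne: "f \<sigma> (int_mult (c i) x) \<noteq> (f \<sigma> x \<noteq> w i)" by blast
    assume good: "x \<notin> N \<sigma> \<union> H"
    have "\<exists>s\<in>S \<inter> (*) (c i) ` S. strict_min (\<sigma> \<circ> \<kappa> x) (K i) s"
    proof (rule ccontr)
      assume none: "\<not> ?thesis"
      have "\<exists>i\<in>I. \<not> (\<exists>s\<in>S \<inter> (*) (c i) ` S. strict_min (\<sigma> \<circ> \<kappa> x) (K i) s)"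
        by (rule bexI[of _ i]) (fact none, fact i)
      then have "x \<in> N \<sigma> \<union> H" by (simp only: N_def Un_iff Diff_iff mem_Collect_eq simp_thms)
      with good show False ..
    qed
    then obtain s where s: "s \<in> S" "s \<in> (*) (c i) ` S" "strict_min (\<sigma> \<circ> \<kappa> x) (K i) s"
      by (elim bexE IntE)
    from s(2) obtain t where t: "t \<in> S" "s = c i * t" by (elim imageE)
    have "strict_min (\<sigma> \<circ> \<kappa> x) S s"
      using s(3,1) by (rule strict_min_subset) (auto simp: K_def)
    then have 1: "f \<sigma> x = \<xi> s" by (rule f_eq[OF s(1)])
    \<comment> \<open>The label of t (c_i x) is that of (c_i t) x. Minimising over \<open>S\<close>
      at c_i x is therefore minimising over the multiple of \<open>S\<close> by c_i at x, and s =
      c_i t is the minimiser for both.\<close>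
    have \<kappa>: "\<kappa> (int_mult (c i) x) = \<kappa> x \<circ> (*) (c i)"
      by (simp add: fun_eq_iff \<kappa>_def int_mult_int_mult)
    have "strict_min (\<sigma> \<circ> \<kappa> x) ((*) (c i) ` S) (c i * t)"
      using s(3) unfolding t(2) by (rule strict_min_subset) (use t in \<open>auto simp: K_def\<close>)
    then have "strict_min (\<sigma> \<circ> \<kappa> (int_mult (c i) x)) S t"
      using c[OF i] t(1) by (subst (asm) strict_min_reindex) (auto simp: inj_on_def \<kappa> comp_assoc)
    then have "f \<sigma> (int_mult (c i) x) = \<xi> t" by (rule f_eq[OF t(1)])
    with 1 ne \<xi>[OF i t(1)] t(2) show False by auto
  qed
  then have "prob {x. \<exists>i\<in>I. f \<sigma> (int_mult (c i) x) \<noteq> (f \<sigma> x \<noteq> w i)} \<le> prob (N \<sigma> \<union> H)"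
    using N H by (intro finite_measure_mono) auto
  also have "\<dots> \<le> prob (N \<sigma>) + prob H"
    using N H by (intro measure_Un_le) auto
  also have "\<dots> \<le> 2 * \<delta> * card I + \<eta>"
    using \<sigma>(2) \<eta>' unfolding H_def \<kappa>_def[abs_def] by linarith
  finally show ?thesis using f by blast
qed

section \<open>Monomials in multiplicatively independent integers\<close>

definition monomial :: "nat \<Rightarrow> (nat \<Rightarrow> int) \<Rightarrow> (nat \<Rightarrow> nat) \<Rightarrow> int" where
  "monomial d c n = (\<Prod>i\<in>{1..d}. c i ^ n i)"

lemma monomial_Suc:
  assumes "i \<in> {1..d}"
  shows "monomial d c (n(i := Suc (n i))) = c i * monomial d c n"
proof -
  have "(\<Prod>j\<in>{1..d}-{i}. c j ^ (n(i := Suc (n i))) j) = (\<Prod>j\<in>{1..d}-{i}. c j ^ n j)"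
    by (intro prod.cong) auto
  then show ?thesis
    unfolding monomial_def prod.remove[OF finite_atLeastAtMost assms] by simp
qed

text \<open>The quotient of two equal monomials is a multiplicative relation with exponents n - m,
  so independence gives equality on \<open>{1..d}\<close>; extensionality fixes the exponents
  elsewhere.\<close>

lemma inj_on_monomial:
  assumes c: "\<forall>i\<in>{1..d}. c i \<noteq> 0" and ind: "mult_independent {1..d} c"
  shows "inj_on (monomial d c) (extensional {1..d})"
proof (rule inj_onI)
  fix n m assume ext: "n \<in> extensional {1..d}" "m \<in> extensional {1..d}"
    and eq: "monomial d c n = monomial d c m"
  define r where "r n = (\<Prod>i\<in>{1..d}. (of_int (c i) :: rat) ^ n i)" for n
  have r: "r n = of_int (monomial d c n)" for n by (simp add: r_def monomial_def)
  have "(\<Prod>i\<in>{1..d}. (of_int (c i) :: rat) powi (int (n i) - int (m i)))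
      = (\<Prod>i\<in>{1..d}. of_int (c i) ^ n i / of_int (c i) ^ m i)"
    using c by (intro prod.cong refl) (simp add: power_int_diff)
  also have "\<dots> = r n / r m" by (simp add: r_def prod_dividef)
  also have "\<dots> = 1" using c eq unfolding r by (simp add: monomial_def)
  finally have "\<forall>i\<in>{1..d}. int (n i) - int (m i) = 0"
    using ind[unfolded mult_independent_def, rule_format, of "\<lambda>i. int (n i) - int (m i)"] by blast
  then show "n = m" using ext by (intro extensionalityI) auto
qed

text \<open>By injectivity the exponents can be read off from a monomial. Take the parity of the
  total exponent over the indices with \<open>w\<close>: multiplying by c_i raises the i-th exponent
  by one and flips this parity exactly when \<open>w i\<close>.\<close>

lemma ex_parity_character:
  assumes c: "\<forall>i\<in>{1..d}. c i \<noteq> 0" and ind: "mult_independent {1..d} c"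
  shows "\<exists>\<xi>. \<forall>i\<in>{1..d}. \<forall>n\<in>extensional {1..d}.
    \<xi> (c i * monomial d c n) = (\<xi> (monomial d c n) \<noteq> w i)"
proof -
  define v where "v = inv_into (extensional {1..d}) (monomial d c)"
  define \<xi> where "\<xi> z = odd (\<Sum>j\<in>{1..d}. if w j then v z j else 0)" for z
  have v: "v (monomial d c n) = n" if "n \<in> extensional {1..d}" for n
    unfolding v_def by (rule inv_into_f_f[OF inj_on_monomial[OF c ind] that])
  have "\<xi> (c i * monomial d c n) = (\<xi> (monomial d c n) \<noteq> w i)"
    if i: "i \<in> {1..d}" and n: "n \<in> extensional {1..d}" for i n
  proof -
    let ?n = "n(i := Suc (n i))"
    have "?n \<in> extensional {1..d}" using i n by (auto simp: extensional_def)
    then have 1: "v (c i * monomial d c n) = ?n" using v monomial_Suc[OF i, of c n] by metis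
    have "(\<Sum>j\<in>{1..d}-{i}. if w j then ?n j else 0) = (\<Sum>j\<in>{1..d}-{i}. if w j then n j else 0)"
      by (intro sum.cong) auto
    then show ?thesis
      unfolding \<xi>_def 1 v[OF n] sum.remove[OF finite_atLeastAtMost i] by simp
  qed
  then show ?thesis by blast
qed

text \<open>The Folner sets of the multiplicative semigroup generated by the c_i. \<open>PiE\<close>
  keeps the exponents extensional, where \<open>monomial\<close> is injective.\<close>

definition monomial_box :: "nat \<Rightarrow> (nat \<Rightarrow> int) \<Rightarrow> nat \<Rightarrow> int set" where
  "monomial_box d c M = monomial d c ` (PiE {1..d} (\<lambda>_. {..<M}))"

text \<open>A monomial in the box with positive i-th exponent is c_i times another one in the box.
  So the difference lies in the face where that exponent is 0, which has M^(d-1) of the M^d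
  points.\<close>

lemma monomial_box_folner:
  assumes c: "\<forall>i\<in>{1..d}. c i \<noteq> 0" and ind: "mult_independent {1..d} c" and i: "i \<in> {1..d}"
  shows "M * card (monomial_box d c M - (*) (c i) ` monomial_box d c M) \<le> card (monomial_box d c M)"
proof -
  let ?B = "PiE {1..d} (\<lambda>_. {..<M})"
  let ?F = "PiE {1..d} (\<lambda>j. if j = i then {0} else {..<M})"
  have "inj_on (monomial d c) ?B"
    using inj_on_monomial[OF c ind] by (rule inj_on_subset) (auto simp: PiE_def)
  then have cardS: "card (monomial_box d c M) = M ^ d"
    unfolding monomial_box_def by (simp add: card_image card_PiE)
  have "monomial_box d c M - (*) (c i) ` monomial_box d c M \<subseteq> monomial d c ` ?F"
  proof
    fix s assume s: "s \<in> monomial_box d c M - (*) (c i) ` monomial_box d c M"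
    then obtain n where n: "n \<in> ?B" "s = monomial d c n" by (auto simp: monomial_box_def)
    have "n i = 0"
    proof (rule ccontr)
      assume ni: "n i \<noteq> 0"
      define m where "m = n(i := n i - 1)"
      have "m \<in> ?B" using n(1) i by (auto simp: m_def PiE_iff extensional_def less_imp_diff_less)
      moreover have "n = m(i := Suc (m i))" using ni by (auto simp: m_def)
      then have "s = c i * monomial d c m" using monomial_Suc[OF i, of c m] n(2) by simp
      ultimately show False using s by (auto simp: monomial_box_def)
    qed
    then have "n \<in> ?F" using n(1) by (auto simp: PiE_iff)
    then show "s \<in> monomial d c ` ?F" using n(2) by blast
  qed
  then have "card (monomial_box d c M - (*) (c i) ` monomial_box d c M) \<le> card (monomial d c ` ?F)"
    by (intro card_mono finite_imageI finite_PiE) auto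
  also have "\<dots> \<le> card ?F" by (intro card_image_le finite_PiE) auto
  also have "\<dots> = M ^ (d - 1)"
    using i by (simp add: card_PiE prod.remove[OF finite_atLeastAtMost i] del: One_nat_def)
  finally show ?thesis
    unfolding cardS using i by (cases d) auto
qed

theorem proposition1p5:
  fixes d :: nat and c :: "nat \<Rightarrow> int" and \<Gamma> :: "nat set set" and \<epsilon> :: real
  assumes "c 0 = 1"
    and "\<forall>i\<in>{1..d}. c i \<noteq> 0"
    and "mult_independent {1..d} c"
    and "bipartite_graph {0..d} \<Gamma>"
    and "\<epsilon> > 0"
  shows "\<exists>A :: torus set. A \<in> sets borel \<and> measure haar A \<ge> 1/2 - \<epsilon> \<and>
    (\<forall>i j. {i, j} \<in> \<Gamma> \<longrightarrow> free_set (c i) (c j) A)"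
proof -
  interpret prob_space haar by (rule prob_space_haar)
  obtain X Y where XY: "X \<union> Y = {0..d}" "X \<inter> Y = {}"
    and edge: "\<forall>e\<in>\<Gamma>. \<exists>x\<in>X. \<exists>y\<in>Y. e = {x, y}"
    using assms(4) unfolding bipartite_graph_def by (elim conjE exE)
  \<comment> \<open>Normalised so that \<open>w 0\<close> is false, as c_0 = 1 requires. Index 0 can
    then be treated like the others, including its edges.\<close>
  define w where "w i \<longleftrightarrow> (i \<in> X) \<noteq> (0 \<in> X)" for i
  obtain \<xi> where \<xi>: "\<And>i n. i \<in> {1..d} \<Longrightarrow> n \<in> extensional {1..d} \<Longrightarrow>
      \<xi> (c i * monomial d c n) = (\<xi> (monomial d c n) \<noteq> w i)"
    using ex_parity_character[OF assms(2,3), of w] by blast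
  define \<eta> where "\<eta> = \<epsilon> / 2"
  have \<eta>: "\<eta> > 0" using assms(5) by (simp add: \<eta>_def)
  \<comment> \<open>This makes the Folner error 2 (d + 1) / M at most \<eta>. Together with the
    collision error \<eta> the total is at most \<epsilon>.\<close>
  obtain M :: nat where M: "real M > 2 * real (Suc d) / \<eta>" using reals_Archimedean2 by blast
  have "2 * real (Suc d) / \<eta> > 0" using \<eta> by simp
  then have M0: "M > 0" using M by (intro gr0I) auto
  let ?S = "monomial_box d c M"
  have "\<exists>f. {x. f x} \<in> sets borel \<and>
    measure haar {x. \<exists>i\<in>{0..d}. f (int_mult (c i) x) \<noteq> (f x \<noteq> w i)}
      \<le> 2 * (1 / M) * card {0..d} + \<eta>"
  proof (rule ex_approximate_eigenfunction)
    show "finite ?S" "?S \<noteq> {}"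
      using M0 by (auto simp: monomial_box_def PiE_eq_empty_iff intro!: finite_PiE)
    fix i assume i: "i \<in> {0..d}"
    show "c i \<noteq> 0" using i assms(1,2) by (cases "i = 0") auto
    show "\<xi> (c i * s) = (\<xi> s \<noteq> w i)" if "s \<in> ?S" for s
      using that i \<xi>[of i] assms(1) by (cases "i = 0") (auto simp: monomial_box_def w_def PiE_def)
    show "real (card (?S - (*) (c i) ` ?S)) \<le> 1 / M * card ?S"
    proof (cases "i = 0")
      case True
      then show ?thesis using assms(1) by simp
    next
      case False
      then have "M * card (?S - (*) (c i) ` ?S) \<le> card ?S"
        using i by (intro monomial_box_folner[OF assms(2,3)]) auto
      then have "real M * card (?S - (*) (c i) ` ?S) \<le> card ?S"
        by (metis of_nat_le_iff of_nat_mult)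
      then show ?thesis using M0 by (simp add: field_simps)
    qed
  qed (use \<eta> in auto)
  then obtain f where f: "{x. f x} \<in> sets borel"
    and bad: "measure haar {x. \<exists>i\<in>{0..d}. f (int_mult (c i) x) \<noteq> (f x \<noteq> w i)}
      \<le> 2 * (1 / M) * card {0..d} + \<eta>"
    by blast
  define N where "N = {x. \<exists>i\<in>{0..d}. f (int_mult (c i) x) \<noteq> (f x \<noteq> w i)}"
  have "2 * (1 / M) * card {0..d} \<le> \<eta>"
  proof -
    have "2 * real (Suc d) < M * \<eta>" using M by (simp only: pos_divide_less_eq[OF \<eta>])
    then show ?thesis using M0 by (simp add: divide_le_eq mult.commute)
  qed
  with bad have "prob N \<le> \<eta> + \<eta>" unfolding N_def by linarith
  then have N_le: "prob N \<le> \<epsilon>" by (simp add: \<eta>_def)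
  have N: "N \<in> sets borel"
  proof -
    have [measurable]: "Measurable.pred borel f" using f by (simp add: pred_def)
    have "Measurable.pred borel (\<lambda>x. \<exists>i\<in>{0..d}. f (int_mult (c i) x) \<noteq> (f x \<noteq> w i))"
      by measurable
    then show ?thesis by (simp add: pred_def N_def)
  qed
  have level: "{x. f x = b} \<in> sets borel" for b
    using f borel_comp[OF f] by (cases b) (auto simp: Collect_neg_eq)
  \<comment> \<open>The two level sets partition the torus, so the larger one has measure at least
    1/2, and removing \<open>N\<close> costs at most \<epsilon>.\<close>
  have "prob {x. f x = True} + prob {x. f x = False} = 1"
    using f prob_compl[of "{x. f x}"] by (simp add: Collect_neg_eq Compl_eq_Diff_UNIV)
  then have "prob {x. f x = True} \<ge> 1 / 2 \<or> prob {x. f x = False} \<ge> 1 / 2" by linarith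
  then obtain b where b: "prob {x. f x = b} \<ge> 1 / 2" by (elim disjE)
  define A where "A = {x. f x = b} - N"
  have "prob {x. f x = b} \<le> prob (A \<union> N)"
    using level N by (intro finite_measure_mono) (auto simp: A_def)
  also have "\<dots> \<le> prob A + prob N"
    using level N by (intro measure_Un_le) (auto simp: A_def)
  finally have "prob A \<ge> 1 / 2 - \<epsilon>" using b N_le by linarith
  moreover have "A \<in> sets borel" using level N by (auto simp: A_def)
  moreover have "free_set (c i) (c j) A" if e: "{i, j} \<in> \<Gamma>" for i j
  proof -
    obtain x y where xy: "x \<in> X" "y \<in> Y" "{i, j} = {x, y}"
      using bspec[OF edge e] by (elim bexE)
    have "x \<in> {0..d}" "y \<in> {0..d}" unfolding XY(1)[symmetric] using xy by auto
    moreover have "w x \<noteq> w y" using xy(1,2) XY(2) by (auto simp: w_def)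
    ultimately have ij: "i \<in> {0..d}" "j \<in> {0..d}" "w i \<noteq> w j"
      using xy(3) by (auto simp: doubleton_eq_iff)
    \<comment> \<open>On \<open>A\<close> the value of \<open>f\<close> at c_l x depends only on
      \<open>w l\<close>. As \<open>w i\<close> and \<open>w j\<close> differ, \<open>f\<close>
      separates the points c_i x and c_j y for all x, y in \<open>A\<close>.\<close>
    have A: "f (int_mult (c l) x) = (b \<noteq> w l)" if "l \<in> {0..d}" "x \<in> A" for l x
      using that by (auto simp: A_def N_def)
    show ?thesis
      unfolding free_set_def
    proof (intro notI, elim bexE)
      fix x y assume "x \<in> A" "y \<in> A" "int_mult (c i) x = int_mult (c j) y"
      then show False using A[OF ij(1), of x] A[OF ij(2), of y] ij(3) by auto
    qed
  qed
  ultimately show ?thesis by (intro exI[of _ A]) simp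
qed

end
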